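(* For any positive integer $k$ and any $c\in\{1,2,\dots,k\}$, $$T^A(k-c,k+c) = t_k + (2k\,\alpha_k(k)-t_k)\, 2^{-(2k-2)} \sum_{i=k}^{k+c-1}\binom{2k-1}{i}-2k\,\alpha_k(c),$$ $$T^A(k+1-c,k+c) = t_k + \big((2k+1)\beta_k(k+1)-t_k\big)\, \frac{2^{-(2k-1)}}{1+p_k} \sum_{i=k}^{k+c-1}\binom{2k}{i} - (2k+1)\beta_k(c),$$ where $$\alpha_k(n) := \frac{1}{2k-1} \sum_{i=k+1}^{k+n-1} \sum_{j=k}^{i-1} \frac{\binom{2k-1}{i}}{\binom{2k-2}{j}}, \qquad \beta_k(n) := \frac{1}{2k} \sum_{i=k+1}^{k+n-1} \sum_{j=k}^{i-1} \frac{\binom{2k}{i}}{\binom{2k-1}{j}}$$ (empty sums being $0$). The sequence $(t_k)_{k\geq1}$ satisfies the recursion $$t_{k+1} = \frac{1-p_k}{1+p_k}\,t_k + (2k+1)\frac{p_k}{1+p_k} \sum_{i=0}^{k-1}\frac{1}{2i+1},\qquad t_1=0.$$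
   Context: Mabinogion urn model: an urn contains white and black balls. At each time $1,2,3,\dots$ one ball is drawn uniformly at random from the urn, independently of previous selections, its color is observed and it is returned. If the drawn ball is white, one black ball is replaced by a white one; if it is black, one white ball is replaced by a black one. So from a state with $w>0$ white and $b>0$ black balls, a draw leads to $(w+1,b-1)$ with probability $\frac{w}{w+b}$ and to $(w-1,b+1)$ with probability $\frac{b}{w+b}$. The process stops when all remaining balls are of the same color. Policy A: at time $0$ and immediately after each draw, if the number of white balls is greater than or equal to the number of black balls, immediately reduce (by permanently removing white balls) the number of white balls to one less than the number of black balls; otherwise do nothing. The process run under Policy A is the A-controlled M-process; removals take no time. $T^A(w,b)$ denotes the expected time to absorption (expected number of draws until all remaining balls are of the same color) in the A-controlled M-process started with $w$ white and $b$ black balls (Policy A being applied already at time $0$). In particular $T^A(0,b)=0$. Notation: $t_k:=T^A(k,k)$ and $p_k := 2^{-2k}\binom{2k}{k}$. *)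

theory Defs
  imports "HOL-Probability.Probability"
begin

text \<open>A state \<open>(w, b)\<close> of the urn records the numbers of white and of black balls.\<close>

type_synonym urn = "nat \<times> nat"

definition monochromatic :: "urn \<Rightarrow> bool" where
  "monochromatic s \<longleftrightarrow> fst s = 0 \<or> snd s = 0"

text \<open>In \<open>draw\<close>, the balls are numbered, the white ones being the first \<open>w\<close>. The definition is only
  meaningful if both colours are present.\<close>

definition draw :: "urn \<Rightarrow> urn pmf" where
  "draw = (\<lambda>(w, b). map_pmf (\<lambda>ball. if ball < w then (w + 1, b - 1) else (w - 1, b + 1))
                       (pmf_of_set {..<w + b}))"

text \<open>For \<open>b = 0\<close> the prescription ``one white ball less than the number of black balls'' makes no
  sense; the urn is then left unchanged.\<close>

definition policy_A :: "urn \<Rightarrow> urn" where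
  "policy_A = (\<lambda>(w, b). if 0 < b \<and> b \<le> w then (b - 1, b) else (w, b))"

definition kernel_A :: "urn \<Rightarrow> urn pmf" where
  "kernel_A s = (if monochromatic s then return_pmf s else map_pmf policy_A (draw s))"

text \<open>The trajectories of the controlled process are driven by a sequence of independent random maps
  with a common law: the \<open>n\<close>-th map sends each state \<open>s\<close> to a successor
  with distribution \<open>kernel_A s\<close>, independently for different \<open>s\<close>. Following these maps from a given
  state yields the Markov chain with transition kernel \<open>kernel_A\<close>.\<close>

definition driving_space :: "(urn \<Rightarrow> urn) stream measure" where
  "driving_space = stream_space (PiM UNIV (\<lambda>s. measure_pmf (kernel_A s)))"

primrec trajectory :: "urn \<Rightarrow> (urn \<Rightarrow> urn) stream \<Rightarrow> nat \<Rightarrow> urn" where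
  "trajectory s \<omega> 0 = s"
| "trajectory s \<omega> (Suc n) = (\<omega> !! n) (trajectory s \<omega> n)"

text \<open>The infimum is infinite if the trajectory is never absorbed.\<close>

definition absorption_time :: "urn \<Rightarrow> (urn \<Rightarrow> urn) stream \<Rightarrow> ennreal" where
  "absorption_time s \<omega> = (INF n \<in> {n. monochromatic (trajectory s \<omega> n)}. of_nat n)"

definition mean_absorption_time_A :: "nat \<Rightarrow> nat \<Rightarrow> ennreal" where
  "mean_absorption_time_A w b =
     (\<integral>\<^sup>+ \<omega>. absorption_time (policy_A (w, b)) \<omega> \<partial>driving_space)"

text \<open>Since \<open>enn2real\<close> sends \<open>\<infinity>\<close> to \<open>0\<close>, a statement about \<open>T_A w b\<close> carries
  its full meaning only together with \<open>mean_absorption_time_A w b < \<infinity>\<close>.\<close>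

definition T_A :: "nat \<Rightarrow> nat \<Rightarrow> real" where
  "T_A w b = enn2real (mean_absorption_time_A w b)"

definition t_A :: "nat \<Rightarrow> real" where
  "t_A k = T_A k k"

definition p_centre :: "nat \<Rightarrow> real" where
  "p_centre k = real ((2 * k) choose k) / 2 ^ (2 * k)"

definition alpha :: "nat \<Rightarrow> nat \<Rightarrow> real" where
  "alpha k n = 1 / (2 * real k - 1) *
     (\<Sum>i = k + 1..k + n - 1. \<Sum>j = k..i - 1.
        real ((2 * k - 1) choose i) / real ((2 * k - 2) choose j))"

definition beta :: "nat \<Rightarrow> nat \<Rightarrow> real" where
  "beta k n = 1 / (2 * real k) *
     (\<Sum>i = k + 1..k + n - 1. \<Sum>j = k..i - 1.
        real ((2 * k) choose i) / real ((2 * k - 1) choose j))"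

end

theory Submission
  imports Defs
begin

text \<open>
  With \<open>k + c\<close> black balls and a fixed total number \<open>N\<close>, first-step analysis turns the expected
  absorption times into a second-order difference equation in \<open>c\<close>; its boundary values are \<open>t\<^sub>k\<close>
  at \<open>c = 0\<close>, since the policy identifies \<open>(k, k)\<close> and \<open>(k + 1, k)\<close> with \<open>(k - 1, k)\<close>, and \<open>0\<close> at
  \<open>c = N - k\<close>. The equation for the increments is of first order, and binomial coefficients solve
  its homogeneous part. Finiteness comes from the Lyapunov function \<open>w (w + 2 b)\<close>, which decreases
  by at least \<open>1\<close> in expectation at each step.

  The recursion for \<open>t\<^sub>k\<close> is the odd formula at \<open>c = 1\<close>, together with
  \<open>2 \<beta>\<^sub>k(k + 1) = 1 + 1/3 + \<dots> + 1/(2k - 1)\<close>. For the latter, \<open>\<beta>\<^sub>k(k + 1)\<close> is a diagonal sum of the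
  integrals of \<open>y\<^sup>a (2 - y)\<^sup>b\<close> over \<open>[0, 1]\<close>, whose recurrences let the sum telescope in \<open>k\<close>.
\<close>

section \<open>The difference equation for a fixed number of balls\<close>

lemma real_Suc_times_binomial:
  "real (Suc a) * real (Suc n choose Suc a) = real (Suc n) * real (n choose a)"
  by (metis Suc_times_binomial of_nat_mult)

lemma real_Suc_times_binomial_Suc:
  assumes "a \<le> n"
  shows "real (Suc a) * real (n choose Suc a) = (real n - real a) * real (n choose a)"
proof -
  have "real (Suc a) * real (Suc n choose Suc a) =
    real (Suc a) * real (n choose a) + real (Suc a) * real (n choose Suc a)"
    by (simp only: binomial_Suc_Suc of_nat_add distrib_left)
  then show ?thesis
    unfolding real_Suc_times_binomial by (simp add: algebra_simps)
qed

text \<open>In terms of increments the equation reads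
  \<open>m * (h m' - h m'') = (N - m) * (previous increment) - N\<close> with \<open>m\<close> the
  current number of black balls. Since row \<open>N - 1\<close> of Pascal's triangle satisfies the
  homogeneous version, dividing an increment by its binomial coefficient leaves a quantity that
  changes by an explicit summand at each step. Two summations then give \<open>h\<close>.\<close>

lemma solve_difference_equation:
  fixes h :: "nat \<Rightarrow> real"
  assumes k: "1 \<le> k" "2 \<le> N"
    and rec: "\<And>c. 1 \<le> c \<Longrightarrow> k + c < N \<Longrightarrow>
      real N * h c = real N + (real N - real (k + c)) * h (c - 1) + real (k + c) * h (c + 1)"
    and c: "1 \<le> c" "k + c \<le> N"
  shows "h c = h 0 + (h 1 - h 0) / real ((N - 1) choose k) * (\<Sum>i = k..k + c - 1. real ((N - 1) choose i))
      - real N * (1 / (real N - 1) * (\<Sum>i = k + 1..k + c - 1. \<Sum>j = k..i - 1.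
          real ((N - 1) choose i) / real ((N - 2) choose j)))"
proof -
  define D where "D = (h 1 - h 0) / real ((N - 1) choose k)"
  define B where "B i = real ((N - 1) choose i)" for i
  define R where "R i = (\<Sum>j = k..i - 1. 1 / real ((N - 2) choose j))" for i
  have Bk: "B k > 0" if "k < N" using that by (auto simp: B_def)
  have step: "h (Suc c) - h c = B (k + c) * (D - real N / (real N - 1) * (if c = 0 then 0 else R (k + c)))"
    if "k + c < N" for c
    using that
  proof (induction c)
    case 0
    then show ?case using Bk by (simp add: D_def B_def)
  next
    case (Suc c)
    define X where "X = D - real N / (real N - 1) * (if c = 0 then 0 else R (k + c))"
    have IH: "h (Suc c) - h c = B (k + c) * X" using Suc by (simp add: X_def)
    have r: "real N * h (Suc c) = real N + (real N - real (k + Suc c)) * h c + real (k + Suc c) * h (Suc (Suc c))"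
      using rec[of "Suc c"] Suc.prems by simp
    obtain n where "N = 2 + n" using k(2) le_Suc_ex by blast
    then have n: "N = Suc (Suc n)" by simp
    have mn: "k + c \<le> n" using Suc.prems n by simp
    \<comment> \<open>\<open>b1\<close> shows that \<open>B\<close> solves the homogeneous equation;
      \<open>b2\<close> evaluates the integrating factor \<open>m * B m\<close> in the source
      term.\<close>
    have b1: "real (Suc (k + c)) * B (Suc (k + c)) = (real N - real (k + Suc c)) * B (k + c)"
      using real_Suc_times_binomial_Suc[of "k + c" "Suc n"] mn by (simp add: B_def n)
    have b2: "real (Suc (k + c)) * B (Suc (k + c)) = (real N - 1) * real ((N - 2) choose (k + c))"
      using real_Suc_times_binomial[of "k + c" n] by (simp add: B_def n)
    define m where "m = real (Suc (k + c))"
    have m: "m > 0" by (simp add: m_def)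
    have pos: "real ((N - 2) choose (k + c)) > 0" using mn n by simp
    have Rs: "(if c = 0 then 0 else R (k + c)) + 1 / real ((N - 2) choose (k + c)) = R (Suc (k + c))"
      using k(1) by (cases c) (auto simp: R_def)
    have cancel: "x = y" if "m * x = m * y" for x y
      using that m by simp
    have "m * (h (Suc (Suc c)) - h (Suc c)) = (real N - m) * (h (Suc c) - h c) - real N"
      using r by (simp add: m_def algebra_simps)
    also have "\<dots> = m * B (Suc (k + c)) * X - real N"
    proof -
      have "(real N - m) * B (k + c) = m * B (Suc (k + c))"
        using b1 by (simp add: m_def)
      then show ?thesis by (simp only: IH mult.assoc[symmetric])
    qed
    also have "\<dots> = m * (B (Suc (k + c)) * (X - real N / (real N - 1) * (1 / real ((N - 2) choose (k + c)))))"
    proof -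
      \<comment> \<open>By \<open>b2\<close>, dividing the source term \<open>N\<close> by
        \<open>m * B m\<close> gives \<open>N / (N - 1)\<close> times a reciprocal binomial, which
        is the next summand of \<open>R\<close>.\<close>
      have "m * B (Suc (k + c)) * (real N / (real N - 1) * (1 / real ((N - 2) choose (k + c)))) = real N"
        unfolding m_def b2 using pos k(2) by (simp del: of_nat_Suc)
      then show ?thesis by (simp only: right_diff_distrib mult.assoc)
    qed
    finally have "h (Suc (Suc c)) - h (Suc c) = B (Suc (k + c)) * (X - real N / (real N - 1) * (1 / real ((N - 2) choose (k + c))))"
      by (rule cancel)
    also have "X - real N / (real N - 1) * (1 / real ((N - 2) choose (k + c)))
       = D - real N / (real N - 1) * R (Suc (k + c))"
      unfolding Rs[symmetric] X_def by (simp only: distrib_left diff_diff_eq)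
    finally show ?case by simp
  qed
  \<comment> \<open>Summation of the increments. The second sum starts at \<open>k + 1\<close>
    because the increment at \<open>c = 0\<close> carries no \<open>R\<close> term.\<close>
  have "h (Suc c) = h 0 + D * (\<Sum>i = k..k + c. B i) - real N / (real N - 1) * (\<Sum>i = k + 1..k + c. B i * R i)"
    if "k + c < N" for c
    using that
  proof (induction c)
    case 0
    then show ?case using step[of 0] by (simp add: algebra_simps)
  next
    case (Suc c)
    then show ?case using step[of "Suc c"] by (simp add: algebra_simps)
  qed
  from this[of "c - 1"] c
  have "h c = h 0 + D * (\<Sum>i = k..k + c - 1. B i) - real N / (real N - 1) * (\<Sum>i = k + 1..k + c - 1. B i * R i)"
    by simp
  then show ?thesis
    by (simp add: D_def B_def R_def sum_distrib_left)
qed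

section \<open>Binomial tails and the value of \<open>beta k (k + 1)\<close>\<close>

text \<open>A closed form of the integral of \<open>y^a (2 - y)^b\<close> over
  \<open>[0, 1]\<close>. The lemmas below obtain its recurrences from binomial identities, without
  integration.\<close>

definition tail_ratio :: "nat \<Rightarrow> nat \<Rightarrow> real" where
  "tail_ratio a b = (\<Sum>i = Suc a..Suc (a + b). real (Suc (a + b) choose i))
     / (real (Suc (a + b)) * real ((a + b) choose a))"

lemma tail_ratio_0: "tail_ratio a 0 = 1 / (real a + 1)"
  by (simp add: tail_ratio_def)

text \<open>Pascal's rule splits the tail into two tails of row \<open>n\<close>, starting at
  \<open>a\<close> and at \<open>Suc a\<close>; they differ by one term.\<close>

lemma binomial_tail_Suc:
  assumes "a \<le> n"
  shows "(\<Sum>i = Suc a..Suc n. real (Suc n choose i)) = 2 * (\<Sum>i = Suc a..n. real (n choose i)) + real (n choose a)"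
proof -
  have "(\<Sum>i = Suc a..Suc n. real (Suc n choose i)) = (\<Sum>i = a..n. real (Suc n choose Suc i))"
    using sum.shift_bounds_cl_Suc_ivl[of "\<lambda>i. real (Suc n choose i)" a n] by simp
  also have "\<dots> = (\<Sum>i = a..n. real (n choose i)) + (\<Sum>i = a..n. real (n choose Suc i))"
    by (simp add: sum.distrib)
  also have "(\<Sum>i = a..n. real (n choose Suc i)) = (\<Sum>i = Suc a..Suc n. real (n choose i))"
    using sum.shift_bounds_cl_Suc_ivl[of "\<lambda>i. real (n choose i)" a n] by simp
  also have "\<dots> = (\<Sum>i = Suc a..n. real (n choose i))"
    using assms by simp
  also have "(\<Sum>i = a..n. real (n choose i)) = real (n choose a) + (\<Sum>i = Suc a..n. real (n choose i))"
    using assms by (rule sum.atLeast_Suc_atMost)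
  finally show ?thesis by simp
qed

text \<open>For the integrals, the left side integrates the derivative of
  \<open>y^(a+1) (2 - y)^(b+1)\<close>, which goes from 0 to 1. Here it follows by splitting off the
  first term of the longer tail.\<close>

lemma tail_ratio_diff: "(real a + 1) * tail_ratio a (Suc b) - (real b + 1) * tail_ratio (Suc a) b = 1"
proof -
  define n where "n = Suc (a + b)"
  have n: "a \<le> n" "Suc a \<le> n" "real n - real a = real (Suc b)"
    by (auto simp: n_def)
  have e1: "real (Suc b) * real (n choose a) = real (Suc a) * real (n choose Suc a)"
    using real_Suc_times_binomial_Suc[OF n(1)] n(3) by simp
  have e2: "real (Suc a) * real (Suc n choose Suc a) = real (Suc n) * real (n choose a)"
    by (rule real_Suc_times_binomial)
  define S where "S = (\<Sum>i = Suc (Suc a)..Suc n. real (Suc n choose i))"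
  have s: "(\<Sum>i = Suc a..Suc n. real (Suc n choose i)) = real (Suc n choose Suc a) + S"
    unfolding S_def by (rule sum.atLeast_Suc_atMost) (simp add: n_def)
  have t1: "tail_ratio a (Suc b) = (real (Suc n choose Suc a) + S) / (real (Suc n) * real (n choose a))"
    using s by (simp add: tail_ratio_def n_def)
  have t2: "tail_ratio (Suc a) b = S / (real (Suc n) * real (n choose Suc a))"
    by (simp add: tail_ratio_def n_def S_def)
  have p: "real (n choose a) > 0" "real (n choose Suc a) > 0" "real (Suc n) > 0"
    using n by (auto simp: zero_less_binomial)
  have "real (Suc b) * tail_ratio (Suc a) b = real (Suc a) * (S / (real (Suc n) * real (n choose a)))"
    unfolding t2 using e1 p by (simp add: divide_simps)
  moreover have "real (Suc a) * tail_ratio a (Suc b) = 1 + real (Suc a) * (S / (real (Suc n) * real (n choose a)))"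
    unfolding t1 add_divide_distrib distrib_left using e2 p by simp
  ultimately show ?thesis by (simp add: add.commute)
qed

text \<open>For the integrals this is \<open>y + (2 - y) = 2\<close>. Here both tails of row
  \<open>n + 1\<close> are expressed through the same tail \<open>S\<close> of row
  \<open>n\<close>.\<close>

lemma tail_ratio_sum: "tail_ratio (Suc a) b + tail_ratio a (Suc b) = 2 * tail_ratio a b"
proof -
  define n where "n = Suc (a + b)"
  define S where "S = (\<Sum>i = Suc a..n. real (n choose i))"
  have n: "a \<le> n" "Suc a \<le> n" "real n - real a = real (Suc b)" "n > 0"
    by (auto simp: n_def)
  have p: "real (n choose a) > 0" "real (n choose Suc a) > 0" "real n > 0" "real (Suc n) > 0"
    "real ((a + b) choose a) > 0"
    using n by (auto simp: zero_less_binomial)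
  have "(\<Sum>i = Suc a..Suc n. real (Suc n choose i)) = 2 * S + real (n choose a)"
    unfolding S_def by (rule binomial_tail_Suc) (simp add: n_def)
  then have t1: "tail_ratio a (Suc b) = (2 * S + real (n choose a)) / (real (Suc n) * real (n choose a))"
    by (simp add: tail_ratio_def n_def)
  have "S = real (n choose Suc a) + (\<Sum>i = Suc (Suc a)..n. real (n choose i))"
    unfolding S_def by (rule sum.atLeast_Suc_atMost) (simp add: n_def)
  moreover have "(\<Sum>i = Suc (Suc a)..Suc n. real (Suc n choose i))
     = 2 * (\<Sum>i = Suc (Suc a)..n. real (n choose i)) + real (n choose Suc a)"
    by (rule binomial_tail_Suc) (simp add: n_def)
  ultimately have "(\<Sum>i = Suc (Suc a)..Suc n. real (Suc n choose i)) = 2 * S - real (n choose Suc a)"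
    by simp
  then have t2: "tail_ratio (Suc a) b = (2 * S - real (n choose Suc a)) / (real (Suc n) * real (n choose Suc a))"
    by (simp add: tail_ratio_def n_def)
  have t3: "tail_ratio a b = S / (real n * real ((a + b) choose a))"
    by (simp add: tail_ratio_def n_def S_def)
  have e1: "real (Suc a) * real (n choose Suc a) = real n * real ((a + b) choose a)"
    unfolding n_def by (rule real_Suc_times_binomial)
  have e2: "real (Suc b) * real (n choose a) = real n * real ((a + b) choose a)"
    using real_Suc_times_binomial_Suc[OF n(1)] n(3) e1 by simp
  define Q where "Q = real n * real ((a + b) choose a)"
  have Q: "Q > 0" using p by (simp add: Q_def)
  have c1: "1 / real (n choose Suc a) = real (Suc a) / Q" "1 / real (n choose a) = real (Suc b) / Q"
    using e1[folded Q_def] e2[folded Q_def] p Q by (simp_all add: divide_simps)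
  \<comment> \<open>The single binomials in \<open>t1\<close> and \<open>t2\<close> contribute
    \<open>1 / Suc n\<close> with opposite signs and cancel.\<close>
  have "tail_ratio (Suc a) b + tail_ratio a (Suc b)
    = 2 * S / real (Suc n) * (1 / real (n choose Suc a) + 1 / real (n choose a))"
  proof -
    have "(2 * s - y) / (m * y) + (2 * s + x) / (m * x) = 2 * s / m * (1 / y + 1 / x)"
      if "x > 0" "y > 0" "m > 0" for s x y m :: real
    proof -
      have "(2 * s - y) / (m * y) = 2 * s / m * (1 / y) - 1 / m"
        "(2 * s + x) / (m * x) = 2 * s / m * (1 / x) + 1 / m"
        using that by (simp_all add: diff_divide_distrib add_divide_distrib)
      then show ?thesis by (simp only: distrib_left)
    qed
    then show ?thesis unfolding t1 t2 using p by blast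
  qed
  \<comment> \<open>Uses \<open>Suc a + Suc b = Suc n\<close>.\<close>
  also have "\<dots> = 2 * S / real (Suc n) * (real (Suc n) / Q)"
    unfolding c1 by (simp add: n_def add_divide_distrib[symmetric] add.commute)
  also have "\<dots> = 2 * tail_ratio a b"
    unfolding t3 Q_def[symmetric] using p by simp
  finally show ?thesis .
qed

text \<open>Replacing \<open>k\<close> by \<open>k + 1\<close> raises the antidiagonal by two and
  the lower limit by one. In the resulting change all tail ratios cancel, and a single odd
  reciprocal remains.\<close>

lemma tail_ratio_diagonal_sum:
  assumes "1 \<le> k"
  shows "2 * (\<Sum>j = k..2 * k - 1. tail_ratio j (2 * k - 1 - j)) = (\<Sum>i = 0..k - 1. 1 / (2 * real i + 1))"
proof -
  define G where "G n m = (\<Sum>j = m..n. tail_ratio j (n - j))" for n m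
  \<comment> \<open>By \<open>tail_ratio_sum\<close>, twice an entry is the sum of two neighbours on
    the next antidiagonal. Each entry there is hit twice, except the two end ones, which make up the
    right side.\<close>
  have G: "G (Suc n) m - G n m = (tail_ratio m (Suc n - m) + 1 / (real n + 2)) / 2" if "m \<le> n" for n m
  proof -
    have "2 * G n m = (\<Sum>j = m..n. tail_ratio (Suc j) (n - j) + tail_ratio j (Suc n - j))"
      unfolding G_def sum_distrib_left
      by (rule sum.cong) (auto simp: tail_ratio_sum Suc_diff_le)
    also have "\<dots> = (\<Sum>j = m..n. tail_ratio (Suc j) (n - j)) + (\<Sum>j = m..n. tail_ratio j (Suc n - j))"
      by (rule sum.distrib)
    also have "(\<Sum>j = m..n. tail_ratio (Suc j) (n - j)) = (\<Sum>j = Suc m..Suc n. tail_ratio j (Suc n - j))"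
      using sum.shift_bounds_cl_Suc_ivl[of "\<lambda>j. tail_ratio j (Suc n - j)" m n] by simp
    also have "\<dots> = G (Suc n) m - tail_ratio m (Suc n - m)"
      unfolding G_def using that by (subst (2) sum.atLeast_Suc_atMost) auto
    also have "(\<Sum>j = m..n. tail_ratio j (Suc n - j)) = G (Suc n) m - tail_ratio (Suc n) 0"
      unfolding G_def using that by simp
    finally show ?thesis by (simp add: tail_ratio_0 add.commute)
  qed
  \<comment> \<open>Stated with \<open>k + 1\<close> for \<open>k\<close>, so that the bounds
    contain no truncated subtraction.\<close>
  have "2 * G (2 * k + 1) (k + 1) = (\<Sum>i = 0..k. 1 / (2 * real i + 1))" for k
  proof (induction k)
    case 0
    then show ?case by (simp add: G_def tail_ratio_0)
  next
    case (Suc k)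
    have a: "G (2 * k + 2) (k + 1) - G (2 * k + 1) (k + 1) = (tail_ratio (k + 1) (k + 1) + 1 / (2 * real k + 3)) / 2"
      using G[of "k + 1" "2 * k + 1"] by (simp add: numeral_eq_Suc)
    have b: "G (2 * k + 3) (k + 1) - G (2 * k + 2) (k + 1) = (tail_ratio (k + 1) (k + 2) + 1 / (2 * real k + 4)) / 2"
      using G[of "k + 1" "2 * k + 2"] by (simp add: numeral_eq_Suc)
    have c: "G (2 * k + 3) (k + 1) = tail_ratio (k + 1) (k + 2) + G (2 * k + 3) (k + 2)"
      unfolding G_def by (subst sum.atLeast_Suc_atMost) (auto simp: numeral_eq_Suc)
    have d: "tail_ratio (k + 2) (k + 1) + tail_ratio (k + 1) (k + 2) = 2 * tail_ratio (k + 1) (k + 1)"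
      using tail_ratio_sum[of "k + 1" "k + 1"] by simp
    have "(real k + 2) * (tail_ratio (k + 1) (k + 2) - tail_ratio (k + 2) (k + 1)) = 1"
      using tail_ratio_diff[of "k + 1" "k + 1"] by (simp add: algebra_simps)
    then have e: "tail_ratio (k + 1) (k + 2) - tail_ratio (k + 2) (k + 1) = 2 * (1 / (2 * real k + 4))"
      by (simp add: field_simps)
    \<comment> \<open>The linear combination of \<open>a\<close> to \<open>e\<close>, with the sums
      and tail ratios abstracted to variables.\<close>
    have "2 * z - 2 * x = q"
      if "y - x = (u + q) / 2" "z' - y = (v + r) / 2" "z' = v + z" "w + v = 2 * u" "v - w = 2 * r"
      for x y z z' u v w q r :: real
      using that by argo
    from this[OF a b c d e]
    have "2 * G (2 * k + 3) (k + 2) - 2 * G (2 * k + 1) (k + 1) = 1 / (2 * real k + 3)" .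
    then show ?case using Suc by (simp add: numeral_eq_Suc add.commute)
  qed
  note * = this
  obtain m where m: "k = Suc m" using assms by (cases k) auto
  then have "2 * k - 1 = 2 * m + 1" "k = m + 1" "k - 1 = m" by auto
  then show ?thesis using *[of m] by (simp only: G_def)
qed

text \<open>Exchanging the two sums over the triangle \<open>j < i\<close> turns the inner sum into
  a binomial tail divided by a fixed binomial coefficient.\<close>

lemma beta_Suc:
  assumes "1 \<le> k"
  shows "2 * beta k (k + 1) = (\<Sum>i = 0..k - 1. 1 / (2 * real i + 1))"
proof -
  let ?f = "\<lambda>i j. real ((2 * k) choose i) / real ((2 * k - 1) choose j)"
  have "(\<Sum>i = k + 1..2 * k. \<Sum>j = k..i - 1. ?f i j)
     = (\<Sum>i = k + 1..2 * k. \<Sum>j\<in>{j \<in> {k..2 * k - 1}. j < i}. ?f i j)"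
    by (intro sum.cong) auto
  also have "\<dots> = (\<Sum>j = k..2 * k - 1. \<Sum>i\<in>{i \<in> {k + 1..2 * k}. j < i}. ?f i j)"
    by (rule sum.swap_restrict) auto
  also have "\<dots> = (\<Sum>j = k..2 * k - 1. \<Sum>i = Suc j..2 * k. ?f i j)"
    by (intro sum.cong) auto
  also have "\<dots> = (\<Sum>j = k..2 * k - 1. 2 * real k * tail_ratio j (2 * k - 1 - j))"
  proof (rule sum.cong[OF refl])
    fix j assume j: "j \<in> {k..2 * k - 1}"
    then have "Suc (j + (2 * k - 1 - j)) = 2 * k" "j + (2 * k - 1 - j) = 2 * k - 1" using assms by auto
    then have "tail_ratio j (2 * k - 1 - j) = (\<Sum>i = Suc j..2 * k. real ((2 * k) choose i)) / (2 * real k * real ((2 * k - 1) choose j))"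
      unfolding tail_ratio_def by simp
    then show "(\<Sum>i = Suc j..2 * k. ?f i j) = 2 * real k * tail_ratio j (2 * k - 1 - j)"
      using assms by (simp flip: sum_divide_distrib)
  qed
  finally have *: "(\<Sum>i = k + 1..2 * k. \<Sum>j = k..i - 1. ?f i j)
     = 2 * real k * (\<Sum>j = k..2 * k - 1. tail_ratio j (2 * k - 1 - j))"
    by (simp only: sum_distrib_left)
  have n: "k + (k + 1) - 1 = 2 * k" by simp
  have "beta k (k + 1) = (\<Sum>j = k..2 * k - 1. tail_ratio j (2 * k - 1 - j))"
    unfolding beta_def n * using assms by simp
  then show ?thesis using tail_ratio_diagonal_sum[OF assms] by simp
qed

section \<open>Measurability and first-step analysis on the driving space\<close>

interpretation driving_step: prob_space "PiM UNIV (\<lambda>s. measure_pmf (kernel_A s))"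
  by (rule prob_space_PiM) (rule prob_space_measure_pmf)

interpretation driving: prob_space driving_space
  unfolding driving_space_def by (rule driving_step.prob_space_stream_space)

text \<open>Each step evaluates a random map at a random state. As there are countably many states,
  measurability at each fixed state suffices.\<close>

lemma measurable_trajectory [measurable]:
  "(\<lambda>\<omega>. trajectory s \<omega> n) \<in> measurable driving_space (count_space UNIV)"
proof (induction n)
  case 0
  then show ?case by simp
next
  case (Suc n)
  have "(\<lambda>\<omega>. (\<omega> !! n) s) \<in> measurable driving_space (count_space UNIV)" for s
  proof -
    have "(\<lambda>x. x s) \<in> measurable (PiM UNIV (\<lambda>s. measure_pmf (kernel_A s))) (measure_pmf (kernel_A s))"
      by (rule measurable_component_singleton) simp
    then have "(\<lambda>x. x s) \<in> measurable (PiM UNIV (\<lambda>s. measure_pmf (kernel_A s))) (count_space UNIV)"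
      by simp
    from measurable_compose[OF measurable_snth this] show ?thesis
      unfolding driving_space_def .
  qed
  from measurable_compose_countable[OF this Suc] show ?case by simp
qed

text \<open>Makes the index set independent of \<open>\<omega>\<close>, so that measurability is
  that of a countable infimum.\<close>

lemma absorption_time_eq_INF:
  "absorption_time s \<omega> = (INF n. if monochromatic (trajectory s \<omega> n) then of_nat n else \<infinity>)"
  unfolding absorption_time_def
proof (rule antisym)
  show "(INF n\<in>{n. monochromatic (trajectory s \<omega> n)}. of_nat n)
    \<le> (INF n. if monochromatic (trajectory s \<omega> n) then of_nat n else (\<infinity>::ennreal))"
    by (rule INF_greatest) (auto intro: INF_lower)
  show "(INF n. if monochromatic (trajectory s \<omega> n) then of_nat n else (\<infinity>::ennreal))
    \<le> (INF n\<in>{n. monochromatic (trajectory s \<omega> n)}. of_nat n)"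
  proof (rule INF_greatest)
    fix m assume "m \<in> {n. monochromatic (trajectory s \<omega> n)}"
    then show "(INF n. if monochromatic (trajectory s \<omega> n) then of_nat n else (\<infinity>::ennreal)) \<le> of_nat m"
      by (intro INF_lower2[of m]) auto
  qed
qed

lemma measurable_absorption_time [measurable]:
  "absorption_time s \<in> borel_measurable driving_space"
  unfolding absorption_time_eq_INF[abs_def] by measurable

lemma absorption_time_monochromatic: "monochromatic s \<Longrightarrow> absorption_time s \<omega> = 0"
  unfolding absorption_time_def
  by (intro antisym INF_lower2[of 0]) auto

lemma trajectory_Stream: "trajectory s (x ## \<omega>) (Suc n) = trajectory (x s) \<omega> n"
  by (induction n) auto

lemma absorption_time_Stream:
  assumes "\<not> monochromatic s"
  shows "absorption_time s (x ## \<omega>) = 1 + absorption_time (x s) \<omega>"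
proof -
  define f where "f n = (if monochromatic (trajectory s (x ## \<omega>) n) then of_nat n else (\<infinity>::ennreal))" for n
  have f0: "f 0 = \<infinity>" using assms by (simp add: f_def)
  have "absorption_time s (x ## \<omega>) = (INF n. f n)"
    by (simp only: absorption_time_eq_INF f_def)
  \<comment> \<open>The term at 0 is infinite because \<open>s\<close> is not yet absorbed.\<close>
  also have "\<dots> = (INF n. f (Suc n))"
  proof (rule antisym)
    show "(INF n. f n) \<le> (INF n. f (Suc n))"
      by (rule INF_greatest) (rule INF_lower, simp)
    show "(INF n. f (Suc n)) \<le> (INF n. f n)"
    proof (rule INF_greatest)
      fix n show "(INF n. f (Suc n)) \<le> f n"
        by (cases n) (auto simp: f0 intro: INF_lower)
    qed
  qed
  also have "\<dots> = (INF n. 1 + (if monochromatic (trajectory (x s) \<omega> n) then of_nat n else \<infinity>))"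
    by (intro INF_cong) (auto simp: f_def trajectory_Stream simp del: trajectory.simps(2))
  also have "\<dots> = 1 + absorption_time (x s) \<omega>"
    unfolding absorption_time_eq_INF by (rule INF_ennreal_const_add)
  finally show ?thesis .
qed

text \<open>The first map is independent of the remaining ones, and its value at \<open>s\<close>
  has law \<open>kernel_A s\<close>. The general \<open>f\<close> and \<open>g\<close> cover both
  the absorption time and its truncations.\<close>

lemma nn_integral_driving_step:
  assumes f: "f \<in> borel_measurable driving_space" and g: "\<And>s. g s \<in> borel_measurable driving_space"
    and step: "\<And>x \<omega>. f (x ## \<omega>) = 1 + g (x s) \<omega>"
  shows "(\<integral>\<^sup>+\<omega>. f \<omega> \<partial>driving_space) = 1 + (\<integral>\<^sup>+s'. (\<integral>\<^sup>+\<omega>. g s' \<omega> \<partial>driving_space) \<partial>kernel_A s)"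
proof -
  let ?P = "PiM UNIV (\<lambda>s. measure_pmf (kernel_A s))"
  have "(\<integral>\<^sup>+\<omega>. f \<omega> \<partial>driving_space) = (\<integral>\<^sup>+x. (\<integral>\<^sup>+\<omega>. f (x ## \<omega>) \<partial>driving_space) \<partial>?P)"
    using f unfolding driving_space_def by (rule driving_step.nn_integral_stream_space)
  also have "\<dots> = (\<integral>\<^sup>+x. 1 + (\<integral>\<^sup>+\<omega>. g (x s) \<omega> \<partial>driving_space) \<partial>?P)"
    using g by (simp add: step nn_integral_add driving.emeasure_space_1)
  also have "\<dots> = (\<integral>\<^sup>+s'. 1 + (\<integral>\<^sup>+\<omega>. g s' \<omega> \<partial>driving_space) \<partial>distr ?P (kernel_A s) (\<lambda>x. x s))"
    by (subst nn_integral_distr) (auto intro!: measurable_component_singleton)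
  also have "distr ?P (kernel_A s) (\<lambda>x. x s) = measure_pmf (kernel_A s)"
    by (rule distr_PiM_component) (auto intro: prob_space_measure_pmf)
  also have "(\<integral>\<^sup>+s'. 1 + (\<integral>\<^sup>+\<omega>. g s' \<omega> \<partial>driving_space) \<partial>kernel_A s)
      = 1 + (\<integral>\<^sup>+s'. (\<integral>\<^sup>+\<omega>. g s' \<omega> \<partial>driving_space) \<partial>kernel_A s)"
    by (simp add: nn_integral_add)
  finally show ?thesis .
qed

section \<open>Expected times and the Lyapunov bound\<close>

text \<open>Unlike in \<open>mean_absorption_time_A\<close>, the policy is not applied at time
  0.\<close>

definition expected_time :: "urn \<Rightarrow> ennreal" where
  "expected_time s = (\<integral>\<^sup>+\<omega>. absorption_time s \<omega> \<partial>driving_space)"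

lemma expected_time_monochromatic: "monochromatic s \<Longrightarrow> expected_time s = 0"
  by (simp add: expected_time_def absorption_time_monochromatic)

lemma expected_time_step:
  "\<not> monochromatic s \<Longrightarrow> expected_time s = 1 + (\<integral>\<^sup>+s'. expected_time s' \<partial>kernel_A s)"
  unfolding expected_time_def
  by (rule nn_integral_driving_step) (auto simp: absorption_time_Stream)

text \<open>The absorption time truncated at \<open>n\<close> satisfies a first-step recursion in
  \<open>n\<close>, so induction bounds its mean by \<open>V\<close> on the invariant set; monotone
  convergence removes the truncation.\<close>

lemma expected_time_le_Lyapunov:
  fixes V :: "urn \<Rightarrow> ennreal"
  assumes inv: "\<And>s s'. I s \<Longrightarrow> \<not> monochromatic s \<Longrightarrow> s' \<in> set_pmf (kernel_A s) \<Longrightarrow> I s'"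
    and V: "\<And>s. I s \<Longrightarrow> \<not> monochromatic s \<Longrightarrow> 1 + (\<integral>\<^sup>+s'. V s' \<partial>kernel_A s) \<le> V s"
    and s: "I s"
  shows "expected_time s \<le> V s"
proof -
  define u where "u n s = (\<integral>\<^sup>+\<omega>. inf (absorption_time s \<omega>) (of_nat n) \<partial>driving_space)" for n s
  have "u n s \<le> V s" if "I s" for n s
    using that
  proof (induction n arbitrary: s)
    case 0
    then show ?case by (simp add: u_def inf_min)
  next
    case (Suc n)
    show ?case
    proof (cases "monochromatic s")
      case True
      then show ?thesis by (simp add: u_def absorption_time_monochromatic inf_min)
    next
      case False
      have inf_Suc: "inf (1 + a) (1 + b) = 1 + inf a b" for a b :: ennreal
        by (auto simp: inf_min min_def)
      have "u (Suc n) s = 1 + (\<integral>\<^sup>+s'. u n s' \<partial>kernel_A s)"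
        unfolding u_def
        by (rule nn_integral_driving_step) (auto simp: absorption_time_Stream[OF False] inf_Suc)
      also have "\<dots> \<le> 1 + (\<integral>\<^sup>+s'. V s' \<partial>kernel_A s)"
        using Suc inv[OF Suc.prems False]
        by (intro add_left_mono nn_integral_mono_AE) (auto simp: AE_measure_pmf_iff)
      also have "\<dots> \<le> V s" using V Suc.prems False by blast
      finally show ?thesis .
    qed
  qed
  moreover have "expected_time s = (SUP n. u n s)"
  proof -
    have "absorption_time s \<omega> = (SUP n. inf (absorption_time s \<omega>) (of_nat n))" for \<omega>
      unfolding inf_SUP[symmetric] ennreal_SUP_of_nat_eq_top by simp
    then have "expected_time s = (\<integral>\<^sup>+\<omega>. (SUP n. inf (absorption_time s \<omega>) (of_nat n)) \<partial>driving_space)"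
      by (simp add: expected_time_def)
    also have "\<dots> = (SUP n. u n s)"
      unfolding u_def
      by (rule nn_integral_monotone_convergence_SUP)
        (auto intro!: incseq_SucI le_funI inf_mono simp: add_increasing)
    finally show ?thesis .
  qed
  ultimately show ?thesis using s by (simp add: SUP_least)
qed

section \<open>Finiteness and the first-step equation under the policy\<close>

lemma policy_A_less: "0 < b \<Longrightarrow> fst (policy_A (w, b)) < snd (policy_A (w, b))"
  by (simp add: policy_A_def)

lemma policy_A_eq: "w < b \<Longrightarrow> policy_A (w, b) = (w, b)"
  by (simp add: policy_A_def)

lemma mean_absorption_time_A_eq: "mean_absorption_time_A w b = expected_time (policy_A (w, b))"
  by (simp add: mean_absorption_time_A_def expected_time_def)

lemma kernel_A_eq:
  "0 < w \<Longrightarrow> 0 < b \<Longrightarrow> kernel_A (w, b) = map_pmf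
    (\<lambda>ball. policy_A (if ball < w then (w + 1, b - 1) else (w - 1, b + 1))) (pmf_of_set {..<w + b})"
  by (simp add: kernel_A_def monochromatic_def draw_def pmf.map_comp comp_def)

lemma nn_integral_kernel_A:
  assumes "0 < w" "0 < b"
  shows "(\<integral>\<^sup>+s. f s \<partial>kernel_A (w, b)) =
    (of_nat w * f (policy_A (w + 1, b - 1)) + of_nat b * f (policy_A (w - 1, b + 1))) / of_nat (w + b)"
proof -
  have "(\<Sum>ball<w + b. f (policy_A (if ball < w then (w + 1, b - 1) else (w - 1, b + 1))))
      = (\<Sum>ball<w. f (policy_A (w + 1, b - 1))) + (\<Sum>ball = w..<w + b. f (policy_A (w - 1, b + 1)))"
    by (simp add: lessThan_atLeast0 flip: sum.atLeastLessThan_concat[of 0 w "w + b"])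
  then show ?thesis
    using assms by (simp add: kernel_A_eq nn_integral_pmf_of_set lessThan_empty_iff)
qed

lemma expected_time_finite:
  assumes "fst s < snd s"
  shows "expected_time s < \<infinity>"
proof -
  define v where "v s = real (fst s) * (real (fst s) + 2 * real (snd s))" for s
  have "expected_time s \<le> ennreal (v s)"
  proof (rule expected_time_le_Lyapunov[where I = "\<lambda>s. fst s < snd s"])
    fix s s' :: urn assume s: "fst s < snd s" "\<not> monochromatic s" "s' \<in> set_pmf (kernel_A s)"
    obtain w b where wb: "s = (w, b)" by fastforce
    have "0 < w" "w < b" using s by (auto simp: wb monochromatic_def)
    then have "s' = policy_A (w + 1, b - 1) \<or> s' = policy_A (w - 1, b + 1)"
      using s(3) by (auto simp: wb kernel_A_eq)
    then show "fst s' < snd s'"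
      using policy_A_less[of "b - 1" "w + 1"] policy_A_less[of "b + 1" "w - 1"] \<open>0 < w\<close> \<open>w < b\<close> by auto
  next
    fix s assume s: "fst s < snd s" "\<not> monochromatic s"
    obtain w b where wb: "s = (w, b)" by fastforce
    have w: "0 < w" "w < b" using s by (auto simp: wb monochromatic_def)
    define v1 where "v1 = v (policy_A (w + 1, b - 1))"
    define v2 where "v2 = v (policy_A (w - 1, b + 1))"
    have v: "v1 \<ge> 0" "v2 \<ge> 0" "v s \<ge> 0" by (auto simp: v1_def v2_def v_def)
    \<comment> \<open>The right side is the value without removal; removing white balls can only
      lower \<open>v\<close>.\<close>
    have le1: "v1 \<le> (real w + 1) * (real w + 2 * real b - 1)"
    proof (cases "b - 1 \<le> w + 1")
      case True
      then have "v1 = (real b - 2) * (real b - 2 + 2 * (real b - 1))"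
        using w by (simp add: v1_def policy_A_def v_def of_nat_diff)
      also have "\<dots> \<le> (real w + 1) * (real w + 2 * real b - 1)"
        using w True by (intro mult_mono) auto
      finally show ?thesis .
    next
      case False
      then show ?thesis using w by (simp add: v1_def policy_A_def v_def of_nat_diff)
    qed
    \<comment> \<open>After a black draw white stays in the minority, so the policy does
      nothing.\<close>
    have le2: "v2 = (real w - 1) * (real w + 2 * real b + 1)"
      using w by (simp add: v2_def policy_A_eq v_def of_nat_diff)
    \<comment> \<open>Without removal the expected decrease is
      \<open>1 + 2 * b * d / (w + b)\<close>, at least 1 because black is in the majority.\<close>
    obtain d where d: "b = w + d" using w less_imp_add_positive by blast
    have "real (w + b) + (real w * v1 + real b * v2) \<le>
      real (w + b) + (real w * ((real w + 1) * (real w + 2 * real b - 1)) + real b * v2)"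
      using le1 by (intro add_left_mono add_right_mono mult_left_mono) auto
    also have "\<dots> = real (w + b) * v s - 2 * real b * real d"
      unfolding le2 wb v_def d by (simp add: algebra_simps)
    also have "\<dots> \<le> real (w + b) * v s" by simp
    finally have "1 + (real w * v1 + real b * v2) / real (w + b) \<le> v s"
      using w by (simp add: field_simps)
    then have "ennreal (1 + (real w * v1 + real b * v2) / real (w + b)) \<le> ennreal (v s)"
      by (rule ennreal_leI)
    also have "ennreal (1 + (real w * v1 + real b * v2) / real (w + b))
      = 1 + (of_nat w * ennreal v1 + of_nat b * ennreal v2) / of_nat (w + b)"
      using v w by (simp add: ennreal_of_nat_eq_real_of_nat ennreal_plus ennreal_mult divide_ennreal[symmetric]
        flip: of_nat_add)
    finally show "1 + (\<integral>\<^sup>+s'. ennreal (v s') \<partial>kernel_A s) \<le> ennreal (v s)"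
      using w by (simp add: wb nn_integral_kernel_A v1_def v2_def)
  qed (rule assms)
  also have "\<dots> < \<infinity>" by simp
  finally show ?thesis .
qed

lemma mean_absorption_time_A_finite: "0 < b \<Longrightarrow> mean_absorption_time_A w b < \<infinity>"
  unfolding mean_absorption_time_A_eq by (intro expected_time_finite policy_A_less)

text \<open>The removal after a draw needs no mention, since \<open>T_A\<close> itself applies the
  policy at time 0. Finiteness allows the passage from \<open>ennreal\<close> to reals.\<close>

lemma T_A_step:
  assumes "0 < w" "w < b"
  shows "real (w + b) * T_A w b = real (w + b) + real w * T_A (w + 1) (b - 1) + real b * T_A (w - 1) (b + 1)"
proof -
  have m: "mean_absorption_time_A w' b' = ennreal (T_A w' b')" if "0 < b'" for w' b'
    using mean_absorption_time_A_finite[OF that, of w'] by (simp add: T_A_def)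
  have T: "T_A w' b' \<ge> 0" for w' b' by (simp add: T_A_def)
  have "mean_absorption_time_A w b = 1 + (of_nat w * mean_absorption_time_A (w + 1) (b - 1)
      + of_nat b * mean_absorption_time_A (w - 1) (b + 1)) / of_nat (w + b)"
    using assms expected_time_step[of "(w, b)"]
    by (simp add: mean_absorption_time_A_eq policy_A_eq[of w b] nn_integral_kernel_A monochromatic_def)
  then have "ennreal (T_A w b) = 1 + (of_nat w * ennreal (T_A (w + 1) (b - 1))
      + of_nat b * ennreal (T_A (w - 1) (b + 1))) / of_nat (w + b)"
    using assms by (simp add: m)
  also have "\<dots> = ennreal (1 + (real w * T_A (w + 1) (b - 1) + real b * T_A (w - 1) (b + 1)) / real (w + b))"
    using assms T by (simp add: ennreal_of_nat_eq_real_of_nat ennreal_plus ennreal_mult divide_ennreal[symmetric]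
        flip: of_nat_add)
  finally have "T_A w b = 1 + (real w * T_A (w + 1) (b - 1) + real b * T_A (w - 1) (b + 1)) / real (w + b)"
    using T by (subst (asm) ennreal_inj) auto
  then show ?thesis using assms by (simp add: field_simps)
qed

lemma T_A_0: "0 < b \<Longrightarrow> T_A 0 b = 0"
  by (simp add: T_A_def mean_absorption_time_A_eq policy_A_eq expected_time_monochromatic monochromatic_def)

lemma T_A_policy: "policy_A (w, b) = policy_A (w', b') \<Longrightarrow> T_A w b = T_A w' b'"
  by (simp add: T_A_def mean_absorption_time_A_eq)

section \<open>Boundary values and the closed formulas\<close>

lemma binomial_sum_reflect:
  assumes "a \<le> n"
  shows "(\<Sum>i = a..n. real (n choose i)) = (\<Sum>i = 0..n - a. real (n choose i))"
  by (rule sum.reindex_bij_witness[where i = "\<lambda>i. n - i" and j = "\<lambda>i. n - i"])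
    (use assms in \<open>auto simp: binomial_symmetric[symmetric]\<close>)

text \<open>A row with an even number of entries splits into two mirror halves.\<close>

lemma upper_half_binomial_sum_odd:
  assumes "1 \<le> k"
  shows "(\<Sum>i = k..2 * k - 1. real ((2 * k - 1) choose i)) = 2 ^ (2 * k - 2)"
proof -
  have "(\<Sum>i = k..2 * k - 1. real ((2 * k - 1) choose i)) = (\<Sum>i = 0..<k. real ((2 * k - 1) choose i))"
    using assms by (subst binomial_sum_reflect) (auto intro!: sum.cong)
  moreover have "(\<Sum>i = 0..<k. real ((2 * k - 1) choose i)) + (\<Sum>i = k..<2 * k. real ((2 * k - 1) choose i))
    = (\<Sum>i = 0..<2 * k. real ((2 * k - 1) choose i))"
    by (rule sum.atLeastLessThan_concat) auto
  moreover have "{k..<2 * k} = {k..2 * k - 1}" "{0..<2 * k} = {..2 * k - 1}"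
    using assms by auto
  moreover have "(\<Sum>i\<le>2 * k - 1. real ((2 * k - 1) choose i)) = 2 ^ (2 * k - 1)"
    using choose_row_sum[of "2 * k - 1"] by (metis of_nat_numeral of_nat_power of_nat_sum)
  moreover have "(2::real) ^ (2 * k - 1) = 2 * 2 ^ (2 * k - 2)"
    using assms by (simp flip: power_Suc add: Suc_diff_Suc numeral_2_eq_2)
  ultimately show ?thesis by simp
qed

text \<open>Both halves include the central coefficient, so twice the sum is the row total plus that
  coefficient; this is the source of \<open>1 + p_centre k\<close>.\<close>

lemma upper_half_binomial_sum_even:
  assumes "1 \<le> k"
  shows "(\<Sum>i = k..2 * k. real ((2 * k) choose i)) = 2 ^ (2 * k - 1) * (1 + p_centre k)"
proof -
  have "(\<Sum>i = k..2 * k. real ((2 * k) choose i)) = (\<Sum>i = 0..k. real ((2 * k) choose i))"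
    by (subst binomial_sum_reflect) auto
  moreover have "(\<Sum>i = 0..<k. real ((2 * k) choose i)) + (\<Sum>i = k..2 * k. real ((2 * k) choose i))
    = (\<Sum>i\<le>2 * k. real ((2 * k) choose i))"
  proof -
    have "{k..<2 * k + 1} = {k..2 * k}" "{0..<2 * k + 1} = {..2 * k}"
      by auto
    then show ?thesis
      using sum.atLeastLessThan_concat[of 0 k "2 * k + 1" "\<lambda>i. real ((2 * k) choose i)"] by simp
  qed
  moreover have "(\<Sum>i\<le>2 * k. real ((2 * k) choose i)) = 2 ^ (2 * k)"
    using choose_row_sum[of "2 * k"] by (metis of_nat_numeral of_nat_power of_nat_sum)
  moreover have "(\<Sum>i = 0..k. real ((2 * k) choose i)) = (\<Sum>i = 0..<k. real ((2 * k) choose i)) + real ((2 * k) choose k)"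
    by (simp add: atLeastLessThanSuc_atLeastAtMost[symmetric])
  moreover have "2 * 2 ^ (2 * k - 1) * (1 + p_centre k) = 2 ^ (2 * k) + real ((2 * k) choose k)"
  proof -
    have "2 * 2 ^ (2 * k - 1) = (2::real) ^ (2 * k)" using assms by (simp flip: power_Suc)
    then show ?thesis by (simp add: p_centre_def distrib_left)
  qed
  ultimately show ?thesis by linarith
qed

text \<open>The zero at the absorbed end, where the binomial sum is the full \<open>S\<close>,
  determines the free constant \<open>D\<close>.\<close>

lemma solve_boundary_problem:
  fixes h :: "nat \<Rightarrow> real"
  assumes k: "1 \<le> k" "2 \<le> N" "k < N"
    and rec: "\<And>c. 1 \<le> c \<Longrightarrow> k + c < N \<Longrightarrow>
      real N * h c = real N + (real N - real (k + c)) * h (c - 1) + real (k + c) * h (c + 1)"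
    and h: "h (N - k) = 0"
    and S: "(\<Sum>i = k..N - 1. real ((N - 1) choose i)) = S" "S > 0"
    and A: "\<And>n. A n = 1 / (real N - 1) * (\<Sum>i = k + 1..k + n - 1. \<Sum>j = k..i - 1.
          real ((N - 1) choose i) / real ((N - 2) choose j))"
    and c: "1 \<le> c" "k + c \<le> N"
  shows "h c = h 0 + (real N * A (N - k) - h 0) * (1 / S) * (\<Sum>i = k..k + c - 1. real ((N - 1) choose i))
      - real N * A c"
proof -
  define D where "D = (h 1 - h 0) / real ((N - 1) choose k)"
  have h_eq: "h c = h 0 + D * (\<Sum>i = k..k + c - 1. real ((N - 1) choose i)) - real N * A c"
    if "1 \<le> c" "k + c \<le> N" for c
    using solve_difference_equation[OF k(1,2) rec that] by (simp add: D_def A)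
  from h_eq[of "N - k"] have "0 = h 0 + D * S - real N * A (N - k)"
    using k h S by simp
  then have "D = (real N * A (N - k) - h 0) * (1 / S)"
    using S by (simp add: field_simps)
  then show ?thesis using h_eq[OF c] by simp
qed

lemma T_A_even:
  assumes "1 \<le> k" "c \<in> {1..k}"
  shows "T_A (k - c) (k + c) = t_A k + (2 * real k * alpha k k - t_A k) * (1 / 2 ^ (2 * k - 2)) *
      (\<Sum>i = k..k + c - 1. real ((2 * k - 1) choose i)) - 2 * real k * alpha k c"
proof -
  define h where "h c = T_A (k - c) (k + c)" for c
  have "h c = h 0 + (real (2 * k) * alpha k (2 * k - k) - h 0) * (1 / 2 ^ (2 * k - 2)) *
      (\<Sum>i = k..k + c - 1. real ((2 * k - 1) choose i)) - real (2 * k) * alpha k c"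
  proof (rule solve_boundary_problem)
    \<comment> \<open>Here \<open>0 < k - c\<close>, so the truncated subtractions are exact, and
      \<open>1 \<le> c\<close> puts black in the majority, as \<open>T_A_step\<close>
      demands.\<close>
    fix c assume c: "1 \<le> c" "k + c < 2 * k"
    then have "k - c + 1 = k - (c - 1)" "k + c - 1 = k + (c - 1)" "k - c - 1 = k - (c + 1)"
      "real (k - c) = real (2 * k) - real (k + c)" "k - c + (k + c) = 2 * k"
      by (auto simp: of_nat_diff)
    then show "real (2 * k) * h c = real (2 * k) + (real (2 * k) - real (k + c)) * h (c - 1) + real (k + c) * h (c + 1)"
      using T_A_step[of "k - c" "k + c"] c by (simp add: h_def)
  qed (use assms upper_half_binomial_sum_odd[of k] in \<open>auto simp: h_def T_A_0 alpha_def\<close>)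
  moreover have "2 * k - k = k" by simp
  ultimately show ?thesis by (simp add: h_def t_A_def)
qed

lemma T_A_odd:
  assumes "1 \<le> k" "c \<in> {1..k + 1}"
  shows "T_A (k + 1 - c) (k + c) = t_A k + ((2 * real k + 1) * beta k (k + 1) - t_A k) *
      ((1 / 2 ^ (2 * k - 1)) / (1 + p_centre k)) *
      (\<Sum>i = k..k + c - 1. real ((2 * k) choose i)) - (2 * real k + 1) * beta k c"
proof -
  define h where "h c = T_A (k + 1 - c) (k + c)" for c
  have p: "0 \<le> p_centre k" by (simp add: p_centre_def)
  have "h c = h 0 + (real (2 * k + 1) * beta k (2 * k + 1 - k) - h 0) * (1 / (2 ^ (2 * k - 1) * (1 + p_centre k))) *
      (\<Sum>i = k..k + c - 1. real ((2 * k + 1 - 1) choose i)) - real (2 * k + 1) * beta k c"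
  proof (rule solve_boundary_problem)
    fix c assume c: "1 \<le> c" "k + c < 2 * k + 1"
    then have "k + 1 - c + 1 = k + 1 - (c - 1)" "k + c - 1 = k + (c - 1)" "k + 1 - c - 1 = k + 1 - (c + 1)"
      "real (k + 1 - c) = real (2 * k + 1) - real (k + c)" "k + 1 - c + (k + c) = 2 * k + 1"
      by (auto simp: of_nat_diff)
    then show "real (2 * k + 1) * h c = real (2 * k + 1) + (real (2 * k + 1) - real (k + c)) * h (c - 1) + real (k + c) * h (c + 1)"
      using T_A_step[of "k + 1 - c" "k + c"] c by (simp add: h_def)
  qed (use assms p in \<open>auto simp: h_def T_A_0 beta_def upper_half_binomial_sum_even add_pos_nonneg\<close>)
  moreover have "2 * k + 1 - k = k + 1" by simp
  \<comment> \<open>Both \<open>(k + 1, k)\<close> and \<open>(k, k)\<close> are cut to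
    \<open>(k - 1, k)\<close>.\<close>
  moreover have "h 0 = t_A k"
    unfolding h_def t_A_def using assms by (intro T_A_policy) (simp add: policy_A_def)
  moreover have "real (2 * k + 1) = 2 * real k + 1" "2 * k + 1 - 1 = 2 * k" by auto
  ultimately show ?thesis by (simp only: h_def divide_divide_eq_left)
qed

lemma t_A_Suc:
  assumes "1 \<le> k"
  shows "t_A (k + 1) = (1 - p_centre k) / (1 + p_centre k) * t_A k
      + (2 * real k + 1) * (p_centre k / (1 + p_centre k)) * (\<Sum>i = 0..k - 1. 1 / (2 * real i + 1))"
proof -
  define p where "p = p_centre k"
  have p: "1 + p > 0" unfolding p_def by (intro add_pos_nonneg) (auto simp: p_centre_def)
  have b: "beta k 1 = 0" by (simp add: beta_def)
  \<comment> \<open>The policy removes one white ball from \<open>(k + 1, k + 1)\<close>.\<close>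
  have "t_A (k + 1) = T_A (k + 1 - 1) (k + 1)"
    unfolding t_A_def by (intro T_A_policy) (simp add: policy_A_def)
  also have "\<dots> = t_A k + ((2 * real k + 1) * beta k (k + 1) - t_A k) *
      ((1 / 2 ^ (2 * k - 1)) / (1 + p) * real ((2 * k) choose k))"
    using T_A_odd[OF assms, of 1] b by (simp add: p_def)
  \<comment> \<open>At \<open>c = 1\<close> only the central coefficient is left;
    \<open>2 ^ (2 * k - 1)\<close> is half the denominator of \<open>p_centre\<close>, hence the
    factor 2.\<close>
  also have "(1 / 2 ^ (2 * k - 1)) / (1 + p) * real ((2 * k) choose k) = 2 * p / (1 + p)"
  proof -
    have "(2::real) ^ (2 * k) = 2 * 2 ^ (2 * k - 1)" using assms by (simp flip: power_Suc)
    then show ?thesis by (simp add: p_def p_centre_def)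
  qed
  \<comment> \<open>The factor 2 goes to \<open>beta\<close>, and \<open>1 - 2 * p / (1 + p)\<close>
    is \<open>(1 - p) / (1 + p)\<close>.\<close>
  also have "t_A k + ((2 * real k + 1) * beta k (k + 1) - t_A k) * (2 * p / (1 + p))
    = (1 - p) / (1 + p) * t_A k + (2 * real k + 1) * (p / (1 + p)) * (2 * beta k (k + 1))"
    using p by (simp add: divide_simps) (simp add: algebra_simps)
  finally show ?thesis unfolding beta_Suc[OF assms] p_def .
qed

theorem proposition2p4:
  shows "(\<forall>k::nat. k \<ge> 1 \<longrightarrow> (\<forall>c\<in>{1..k}.
            mean_absorption_time_A (k - c) (k + c) < \<infinity> \<and>
            T_A (k - c) (k + c) =
              t_A k + (2 * real k * alpha k k - t_A k) * (1 / 2 ^ (2 * k - 2)) *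
                (\<Sum>i = k..k + c - 1. real ((2 * k - 1) choose i))
              - 2 * real k * alpha k c \<and>
            mean_absorption_time_A (k + 1 - c) (k + c) < \<infinity> \<and>
            T_A (k + 1 - c) (k + c) =
              t_A k + ((2 * real k + 1) * beta k (k + 1) - t_A k) *
                ((1 / 2 ^ (2 * k - 1)) / (1 + p_centre k)) *
                (\<Sum>i = k..k + c - 1. real ((2 * k) choose i))
              - (2 * real k + 1) * beta k c))
       \<and> (\<forall>k::nat. k \<ge> 1 \<longrightarrow> mean_absorption_time_A k k < \<infinity>)
       \<and> (\<forall>k::nat. k \<ge> 1 \<longrightarrow>
            t_A (k + 1) =
              (1 - p_centre k) / (1 + p_centre k) * t_A k
              + (2 * real k + 1) * (p_centre k / (1 + p_centre k)) *
                (\<Sum>i = 0..k - 1. 1 / (2 * real i + 1)))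
       \<and> t_A 1 = 0"
proof (intro conjI allI impI ballI)
  fix k c :: nat assume k: "1 \<le> k" "c \<in> {1..k}"
  show "mean_absorption_time_A (k - c) (k + c) < \<infinity>" "mean_absorption_time_A (k + 1 - c) (k + c) < \<infinity>"
    using mean_absorption_time_A_finite[of "k + c"] k by auto
  show "T_A (k - c) (k + c) = t_A k + (2 * real k * alpha k k - t_A k) * (1 / 2 ^ (2 * k - 2)) *
      (\<Sum>i = k..k + c - 1. real ((2 * k - 1) choose i)) - 2 * real k * alpha k c"
    using k by (rule T_A_even)
  show "T_A (k + 1 - c) (k + c) = t_A k + ((2 * real k + 1) * beta k (k + 1) - t_A k) *
      ((1 / 2 ^ (2 * k - 1)) / (1 + p_centre k)) *
      (\<Sum>i = k..k + c - 1. real ((2 * k) choose i)) - (2 * real k + 1) * beta k c"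
    using k by (intro T_A_odd) auto
next
  fix k :: nat assume "1 \<le> k"
  then show "mean_absorption_time_A k k < \<infinity>"
    by (intro mean_absorption_time_A_finite) simp
next
  fix k :: nat assume "1 \<le> k"
  then show "t_A (k + 1) = (1 - p_centre k) / (1 + p_centre k) * t_A k
      + (2 * real k + 1) * (p_centre k / (1 + p_centre k)) * (\<Sum>i = 0..k - 1. 1 / (2 * real i + 1))"
    by (rule t_A_Suc)
next
  have "t_A 1 = T_A 0 1"
    unfolding t_A_def by (intro T_A_policy) (simp add: policy_A_def)
  then show "t_A 1 = 0" by (simp add: T_A_0)
qed

end
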